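(* Let $\alpha\geq 2$, $k\geq 3$ be integers with $k\geq\alpha$, and put $d=k-\alpha$. A $k$-connected graph $G$ of order $\alpha+k$ and independence number $\alpha$ is extremal (that is, its number of edges equals $f(\alpha+k,\alpha,k)$) if and only if $$G\cong\overline{K}_\alpha\vee H,$$ where $H$ is a graph of order $k$ satisfying the one of the following conditions that corresponds to $d$: (i) if $d=0$, then $H\cong\overline{K}_k$; (ii) if $d=1$, then $H$ is a tree; (iii) if $d\geq 2$, then $H$ is $d$-connected and has exactly $\lceil kd/2\rceil$ edges.
   Context: All graphs are finite, simple, and undirected. A graph is $k$-connected if it has more than $k$ vertices and deleting any set of fewer than $k$ vertices leaves a connected graph. The independence number of a graph is the maximum cardinality of a set of pairwise nonadjacent vertices. For integers $n,\alpha,k$ for which the class of $k$-connected graphs of order $n$ and independence number (exactly) $\alpha$ is nonempty, $f(n,\alpha,k)$ denotes the minimum number of edges of a graph in this class; a graph in this class attaining the minimum is called extremal. $\overline{K}_s$ is the edgeless graph of order $s$. The join $G\vee H$ is obtained from disjoint copies of $G$ and $H$ by adding every edge with one endpoint in each copy. *)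

theory Defs
  imports Complex_Main "Graph_Theory.Graph_Theory"
begin

text \<open>
  Finite simple graphs are the symmetric, loop-free, finite digraphs without parallel arcs of
  the library, i.e. those \<open>G\<close> with \<open>pair_graph G\<close>. An undirected edge is a pair of
  opposite arcs, and it is counted once, as the unordered pair of its endpoints.
\<close>

definition num_edges :: "'a pair_pre_digraph \<Rightarrow> nat" where
  "num_edges G = card ((\<lambda>(u, v). {u, v}) ` parcs G)"

definition k_connected :: "nat \<Rightarrow> 'a pair_pre_digraph \<Rightarrow> bool" where
  "k_connected k G \<longleftrightarrow>
     k < card (pverts G) \<and>
     (\<forall>S \<subseteq> pverts G. card S < k \<longrightarrow>
        Digraph_Component.connected (with_proj G \<restriction> (pverts G - S)))"

definition independent_set :: "'a pair_pre_digraph \<Rightarrow> 'a set \<Rightarrow> bool" where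
  "independent_set G S \<longleftrightarrow> S \<subseteq> pverts G \<and> (\<forall>u \<in> S. \<forall>v \<in> S. (u, v) \<notin> parcs G)"

definition independence_number :: "'a pair_pre_digraph \<Rightarrow> nat" where
  "independence_number G = Max {card S | S. independent_set G S}"

definition conn_class :: "nat \<Rightarrow> nat \<Rightarrow> nat \<Rightarrow> 'a pair_pre_digraph set" where
  "conn_class n \<alpha> k =
     {G. pair_graph G \<and> k_connected k G \<and> card (pverts G) = n \<and> independence_number G = \<alpha>}"

text \<open>
  The minimum is taken over graphs whose vertices are natural numbers; since the graphs are
  finite, every isomorphism type is represented. The value is meaningful only if the class is
  nonempty.
\<close>

definition min_edges :: "nat \<Rightarrow> nat \<Rightarrow> nat \<Rightarrow> nat" where
  "min_edges n \<alpha> k = (LEAST m. \<exists>G \<in> (conn_class n \<alpha> k :: nat pair_pre_digraph set). num_edges G = m)"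

definition extremal :: "nat \<Rightarrow> nat \<Rightarrow> nat \<Rightarrow> 'a pair_pre_digraph \<Rightarrow> bool" where
  "extremal n \<alpha> k G \<longleftrightarrow> G \<in> conn_class n \<alpha> k \<and> num_edges G = min_edges n \<alpha> k"

definition edgeless :: "nat \<Rightarrow> nat pair_pre_digraph" where
  "edgeless s = \<lparr> pverts = {..<s}, parcs = {} \<rparr>"

definition graph_join ::
  "'a pair_pre_digraph \<Rightarrow> 'b pair_pre_digraph \<Rightarrow> ('a + 'b) pair_pre_digraph" where
  "graph_join G H =
     \<lparr> pverts = Inl ` pverts G \<union> Inr ` pverts H,
       parcs = map_prod Inl Inl ` parcs G \<union> map_prod Inr Inr ` parcs H
         \<union> (Inl ` pverts G) \<times> (Inr ` pverts H)
         \<union> (Inr ` pverts H) \<times> (Inl ` pverts G) \<rparr>"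

definition isomorphic :: "'a pair_pre_digraph \<Rightarrow> 'b pair_pre_digraph \<Rightarrow> bool" where
  "isomorphic G H \<longleftrightarrow> digraph_iso (with_proj G) (with_proj H)"

text \<open>
  The library's \<open>tree\<close> is of no use here: in a symmetric digraph the closed walk
  \<open>a, b, a\<close> along an edge and back counts as a cycle in the sense of
  \<open>pre_digraph.cycle\<close>. In a simple graph represented by \<open>pair_graph\<close> the library cycles of length
  at least 3 are exactly the cycles of the underlying undirected graph.
\<close>

definition undirected_tree :: "'a pair_pre_digraph \<Rightarrow> bool" where
  "undirected_tree G \<longleftrightarrow>
     Digraph_Component.connected (with_proj G) \<and>
     \<not> (\<exists>p. pre_digraph.cycle (with_proj G) p \<and> 3 \<le> length p)"

end

theory Submission
  imports Defs
begin

text \<open>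
  Let \<open>S\<close> be an independent set of size \<open>\<alpha>\<close>. Every vertex has degree at least \<open>k\<close>, and only \<open>k\<close>
  vertices lie outside \<open>S\<close>, so \<open>G\<close> is the join of \<open>S\<close> with the graph \<open>H\<close> induced on the rest.
  Deleting \<open>S\<close> costs \<open>\<alpha>\<close> vertices, hence \<open>G\<close> is \<open>k\<close>-connected iff \<open>H\<close> is \<open>(k - \<alpha>)\<close>-connected; the
  degree bound in \<open>H\<close> then keeps independent sets of \<open>H\<close> at size at most \<open>\<alpha>\<close>. Minimising the edges
  of \<open>G\<close> thus means minimising those of a \<open>d\<close>-connected graph \<open>H\<close> of order \<open>k\<close>, and for \<open>d \<ge> 2\<close>
  Harary's graphs attain the degree bound \<open>\<lceil>k * d / 2\<rceil>\<close>.
\<close>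

section \<open>Simple graphs as relations\<close>

text \<open>Paths must stay inside \<open>W\<close>. The empty set counts as connected, unlike for
  the library's \<open>connected\<close>.\<close>

definition conn_on :: "'a set \<Rightarrow> 'a rel \<Rightarrow> bool" where
  "conn_on W E \<longleftrightarrow> (\<forall>u \<in> W. \<forall>v \<in> W. (u, v) \<in> (Restr E W)\<^sup>*)"

definition edges :: "'a rel \<Rightarrow> 'a set set" where
  "edges E = (\<lambda>(u, v). {u, v}) ` E"

lemma num_edges_eq: "num_edges G = card (edges (parcs G))"
  by (simp add: num_edges_def edges_def)

lemma pair_graph_iff:
  "pair_graph G \<longleftrightarrow>
     finite (pverts G) \<and> parcs G \<subseteq> pverts G \<times> pverts G \<and> sym (parcs G) \<and> irrefl (parcs G)"
proof
  assume "pair_graph G"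
  then interpret pair_graph G .
  show "finite (pverts G) \<and> parcs G \<subseteq> pverts G \<times> pverts G \<and> sym (parcs G) \<and> irrefl (parcs G)"
    using pair_finite_verts in_arcsD1 in_arcsD2 arcs_symmetric no_loops'
    unfolding sym_def irrefl_def by fast
next
  assume *: "finite (pverts G) \<and> parcs G \<subseteq> pverts G \<times> pverts G \<and> sym (parcs G) \<and> irrefl (parcs G)"
  then have "finite (parcs G)"
    using finite_subset by blast
  with * show "pair_graph G"
    by unfold_locales (auto simp: symmetric_def irrefl_def)
qed

lemma pair_graphD:
  assumes "pair_graph G"
  shows "finite (pverts G)" "parcs G \<subseteq> pverts G \<times> pverts G" "sym (parcs G)" "irrefl (parcs G)"
    "finite (parcs G)"
  using assms finite_subset[of "parcs G" "pverts G \<times> pverts G"]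
  unfolding pair_graph_iff by auto

text \<open>The library passes to the symmetric closure of the arcs, which changes nothing here
  because they are symmetric already.\<close>

lemma connected_induce_iff:
  assumes "pair_graph G" "W \<subseteq> pverts G"
  shows "Digraph_Component.connected (with_proj G \<restriction> W) \<longleftrightarrow> W \<noteq> {} \<and> conn_on W (parcs G)"
proof -
  interpret pair_graph G by fact
  have W: "wf_digraph (with_proj G \<restriction> W)"
    using assms(2) by (simp add: wellformed_induce_subgraph)
  interpret W: wf_digraph "mk_symmetric (with_proj G \<restriction> W)"
    using wf_digraph.wellformed_mk_symmetric[OF W] by (simp add: wf_digraph_wp_iff)
  have ends: "parcs (mk_symmetric (with_proj G \<restriction> W)) = Restr (parcs G) W"
    using arcs_symmetric by (auto simp: mk_symmetric_def)
  show ?thesis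
    by (auto simp: connected_def strongly_connected_def W.reachable_conv' conn_on_def ends)
qed

lemma connected_iff:
  assumes "pair_graph G"
  shows "Digraph_Component.connected (with_proj G) \<longleftrightarrow>
    pverts G \<noteq> {} \<and> conn_on (pverts G) (parcs G)"
proof -
  interpret pair_graph G by fact
  have "with_proj G \<restriction> pverts G = with_proj G"
    using in_arcsD1 in_arcsD2 by (intro pre_digraph.equality) (auto simp: induce_subgraph_def)
  then show ?thesis
    using connected_induce_iff[OF assms, of "pverts G"] by simp
qed

text \<open>Nonemptiness of what remains is automatic: fewer than \<open>k\<close> of more than
  \<open>k\<close> vertices are deleted.\<close>

lemma k_connected_iff:
  assumes "pair_graph G"
  shows "k_connected k G \<longleftrightarrow> k < card (pverts G) \<and>
    (\<forall>S \<subseteq> pverts G. card S < k \<longrightarrow> conn_on (pverts G - S) (parcs G))"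
proof -
  have "pverts G - S \<noteq> {}" if "k < card (pverts G)" "S \<subseteq> pverts G" "card S < k" for S
  proof
    assume "pverts G - S = {}"
    then have "pverts G = S" using that(2) by blast
    then show False using that by simp
  qed
  then show ?thesis
    unfolding k_connected_def using connected_induce_iff[OF assms, of "pverts G - _"] by auto
qed

text \<open>In the absence of loops, each edge is the image of exactly two arcs.\<close>

lemma card_arcs:
  assumes "finite E" "sym E" "irrefl E"
  shows "card E = 2 * card (edges E)"
proof -
  have "card {a \<in> E. (\<lambda>(u, v). {u, v}) a = e} = 2" if e: "e \<in> edges E" for e
  proof -
    obtain u v where uv: "(u, v) \<in> E" "e = {u, v}" using e by (auto simp: edges_def)
    then have "u \<noteq> v" "(v, u) \<in> E" using assms by (auto simp: irrefl_def sym_def)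
    then have "{a \<in> E. (\<lambda>(u, v). {u, v}) a = e} = {(u, v), (v, u)}"
      using uv by (auto simp: doubleton_eq_iff)
    then show ?thesis using \<open>u \<noteq> v\<close> by simp
  qed
  then have "(\<Sum>e \<in> edges E. card {a \<in> E. (\<lambda>(u, v). {u, v}) a = e}) = 2 * card (edges E)"
    by simp
  moreover have "card E = (\<Sum>e \<in> edges E. card {a \<in> E. (\<lambda>(u, v). {u, v}) a = e})"
    using sum.image_gen[OF assms(1), of "\<lambda>_. 1::nat" "\<lambda>(u, v). {u, v}"]
    by (simp add: edges_def)
  ultimately show ?thesis by simp
qed

lemma edges_mono: "E \<subseteq> F \<Longrightarrow> edges E \<subseteq> edges F"
  by (auto simp: edges_def)

lemma finite_edges: "finite E \<Longrightarrow> finite (edges E)"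
  by (simp add: edges_def)

text \<open>A graph can thus be given by one orientation \<open>B\<close> of its edges and counted
  from that.\<close>

lemma edges_Un_converse: "edges (B \<union> B\<inverse>) = edges B"
  by (force simp: edges_def insert_commute)

lemma edges_empty_iff: "edges E = {} \<longleftrightarrow> E = {}"
  by (simp add: edges_def)

lemma card_arcs_split:
  assumes "finite V" "S \<subseteq> V" "Restr E S = {}" "E \<subseteq> V \<times> V"
    "S \<times> (V - S) \<subseteq> E" "(V - S) \<times> S \<subseteq> E"
  shows "card E = 2 * (card S * card (V - S)) + card (Restr E (V - S))"
proof -
  let ?W = "V - S"
  have fin: "finite S" "finite ?W" using assms(1,2) finite_subset by auto
  have "E = (S \<times> ?W \<union> ?W \<times> S) \<union> Restr E ?W" using assms(2-6) by blast
  then have "card E = card ((S \<times> ?W \<union> ?W \<times> S) \<union> Restr E ?W)" by simp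
  also have "\<dots> = card (S \<times> ?W \<union> ?W \<times> S) + card (Restr E ?W)"
    using fin by (intro card_Un_disjoint) auto
  also have "card (S \<times> ?W \<union> ?W \<times> S) = card (S \<times> ?W) + card (?W \<times> S)"
    using fin by (intro card_Un_disjoint) auto
  finally show ?thesis by (simp add: card_cartesian_product)
qed

lemma card_edges_split:
  assumes "finite V" "S \<subseteq> V" "Restr E S = {}" "E \<subseteq> V \<times> V" "sym E" "irrefl E"
    "S \<times> (V - S) \<subseteq> E"
  shows "card (edges E) = card S * card (V - S) + card (edges (Restr E (V - S)))"
proof -
  have "finite E" using assms finite_subset by blast
  moreover have "sym (Restr E (V - S))" "irrefl (Restr E (V - S))"
    using assms by (auto simp: sym_def irrefl_def)
  moreover have "(V - S) \<times> S \<subseteq> E" using assms(5,7) by (auto simp: sym_def)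
  ultimately show ?thesis
    using card_arcs_split[OF assms(1-4,7)] card_arcs[OF _ assms(5,6)]
      card_arcs[of "Restr E (V - S)"] by simp
qed

section \<open>Connectivity inside a vertex set, and minimum degree\<close>

lemma conn_on_sym:
  assumes "sym E" "(u, v) \<in> (Restr E W)\<^sup>*"
  shows "(v, u) \<in> (Restr E W)\<^sup>*"
proof -
  have "sym (Restr E W)" using assms(1) by (auto simp: sym_def)
  then show ?thesis using assms(2) sym_rtrancl by (metis symD)
qed

lemma conn_onI_root:
  assumes "sym E" "\<And>v. v \<in> W \<Longrightarrow> (r, v) \<in> (Restr E W)\<^sup>*"
  shows "conn_on W E"
  unfolding conn_on_def using assms conn_on_sym by (metis rtrancl_trans)

lemma conn_on_image:
  assumes "conn_on W E"
  shows "conn_on (f ` W) (map_prod f f ` E)"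
proof -
  have "(f u, f v) \<in> (Restr (map_prod f f ` E) (f ` W))\<^sup>*" if "(u, v) \<in> (Restr E W)\<^sup>*" for u v
    using that
  proof induction
    case (step y z)
    then have "(f y, f z) \<in> Restr (map_prod f f ` E) (f ` W)" by force
    with step.IH show ?case by (rule rtrancl_into_rtrancl)
  qed simp
  then show ?thesis using assms by (auto simp: conn_on_def)
qed

text \<open>If \<open>v\<close> had fewer than \<open>k\<close> neighbours, deleting them would
  separate \<open>v\<close> from some other vertex \<open>w\<close>, which exists because the order
  exceeds \<open>k\<close>.\<close>

lemma k_connected_degree:
  assumes "pair_graph G" "k_connected k G" "v \<in> pverts G"
  shows "k \<le> card (parcs G `` {v})"
proof (rule ccontr)
  note G = pair_graphD[OF assms(1)]
  let ?V = "pverts G" and ?N = "parcs G `` {v}"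
  assume "\<not> k \<le> card ?N"
  then have N: "card ?N < k" "?N \<subseteq> ?V" using G by auto
  have "v \<notin> ?N" using G by (auto simp: irrefl_def)
  have finN: "finite ?N" using N(2) G(1) finite_subset by blast
  have "k < card ?V" "conn_on (?V - ?N) (parcs G)"
    using assms N k_connected_iff by metis+
  have "card (insert v ?N) < card ?V" using N(1) \<open>k < card ?V\<close> finN \<open>v \<notin> ?N\<close> by simp
  then have "\<not> ?V \<subseteq> insert v ?N" using finN card_mono[of "insert v ?N" ?V] by auto
  then obtain w where w: "w \<in> ?V" "w \<noteq> v" "w \<notin> ?N" by auto
  then have "(v, w) \<in> (Restr (parcs G) (?V - ?N))\<^sup>*"
    using \<open>conn_on _ _\<close> assms(3) \<open>v \<notin> ?N\<close> by (auto simp: conn_on_def)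
  then show False using w(2) by (cases rule: converse_rtranclE) auto
qed

lemma degree_sum_le:
  assumes "pair_graph G" "\<And>v. v \<in> pverts G \<Longrightarrow> d \<le> card (parcs G `` {v})"
  shows "card (pverts G) * d \<le> 2 * num_edges G"
proof -
  note G = pair_graphD[OF assms(1)]
  have "parcs G = (SIGMA v:pverts G. parcs G `` {v})" using G by auto
  then have "card (parcs G) = (\<Sum>v\<in>pverts G. card (parcs G `` {v}))"
    using G by (metis card_SigmaI finite_Image finite.emptyI finite.insertI)
  also have "\<dots> \<ge> (\<Sum>v\<in>pverts G. d)" using assms(2) by (rule sum_mono)
  finally show ?thesis using card_arcs[OF G(5,3,4)] by (simp add: num_edges_eq)
qed

text \<open>The library's isomorphisms carry separate maps for vertices, arcs, heads and tails.
  Between graphs with projections as ends, the head and tail maps must be \<open>snd\<close> and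
  \<open>fst\<close>, so the vertex map determines the arc map.\<close>

lemma isomorphic_iff:
  assumes "pair_graph G"
  shows "isomorphic G H \<longleftrightarrow> (\<exists>f. inj_on f (pverts G) \<and> pverts H = f ` pverts G \<and>
    parcs H = map_prod f f ` parcs G)"
proof
  interpret pair_graph G by fact
  assume "isomorphic G H"
  then obtain h where h: "digraph_isomorphism h" and H: "with_proj H = app_iso h (with_proj G)"
    by (auto simp: isomorphic_def digraph_iso_def)
  have th: "iso_tail h = fst" "iso_head h = snd"
    using arg_cong[OF H, of tail] arg_cong[OF H, of head] by auto
  have V: "pverts H = iso_verts h ` pverts G" and E: "parcs H = iso_arcs h ` parcs G"
    using arg_cong[OF H, of verts] arg_cong[OF H, of arcs] by auto
  have "iso_arcs h a = map_prod (iso_verts h) (iso_verts h) a" if "a \<in> parcs G" for a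
    using h that by (auto simp: digraph_isomorphism_def th prod_eq_iff)
  then have "parcs H = map_prod (iso_verts h) (iso_verts h) ` parcs G"
    unfolding E by (rule image_cong[OF refl])
  moreover have "inj_on (iso_verts h) (pverts G)"
    using h by (auto simp: digraph_isomorphism_def)
  ultimately show "\<exists>f. inj_on f (pverts G) \<and> pverts H = f ` pverts G \<and>
    parcs H = map_prod f f ` parcs G" using V by blast
next
  interpret pair_graph G by fact
  assume "\<exists>f. inj_on f (pverts G) \<and> pverts H = f ` pverts G \<and> parcs H = map_prod f f ` parcs G"
  then obtain f where f: "inj_on f (pverts G)" "pverts H = f ` pverts G"
    "parcs H = map_prod f f ` parcs G" by blast
  define h where "h = \<lparr>iso_verts = f, iso_arcs = map_prod f f, iso_head = snd, iso_tail = fst\<rparr>"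
  have "inj_on (map_prod f f) (parcs G)"
    using inj_on_subset[OF map_prod_inj_on[OF f(1) f(1)]] pair_graphD(2)[OF assms] by blast
  then have "digraph_isomorphism h"
    using f(1) wf_digraph by (auto simp: digraph_isomorphism_def h_def)
  moreover have "with_proj H = app_iso h (with_proj G)"
    using f(2,3) by (simp add: app_iso_def h_def with_proj_def)
  ultimately show "isomorphic G H" by (auto simp: isomorphic_def digraph_iso_def)
qed

lemma pair_graph_image:
  assumes "pair_graph G" "inj_on f (pverts G)"
  shows "pair_graph \<lparr>pverts = f ` pverts G, parcs = map_prod f f ` parcs G\<rparr>"
proof -
  note G = pair_graphD[OF assms(1)]
  have "irrefl (map_prod f f ` parcs G)"
  proof (rule irreflI, rule notI)
    fix x assume "(x, x) \<in> map_prod f f ` parcs G"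
    then obtain a b where ab: "(a, b) \<in> parcs G" "f a = f b" by auto
    then have "a = b" using assms(2) G(2) by (auto dest: inj_onD)
    then show False using ab(1) G(4) by (simp add: irrefl_def)
  qed
  moreover have "sym (map_prod f f ` parcs G)"
    using G(3) unfolding sym_def by force
  ultimately show ?thesis using G(1,2) by (auto simp: pair_graph_iff)
qed

lemma k_connected_image:
  assumes "pair_graph G" "inj_on f (pverts G)" "k_connected k G"
  shows "k_connected k \<lparr>pverts = f ` pverts G, parcs = map_prod f f ` parcs G\<rparr>"
proof -
  let ?V = "pverts G"
  have "conn_on (f ` ?V - T) (map_prod f f ` parcs G)" if T: "T \<subseteq> f ` ?V" "card T < k" for T
  proof -
    define S where "S = ?V \<inter> f -` T"
    have "f ` S = T" using T(1) by (auto simp: S_def)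
    moreover have "inj_on f S" using assms(2) by (auto simp: S_def inj_on_def)
    ultimately have "card S < k" using T(2) card_image by metis
    then have "conn_on (?V - S) (parcs G)"
      using assms(3) k_connected_iff[OF assms(1)] by (auto simp: S_def)
    moreover have "f ` (?V - S) = f ` ?V - T" by (auto simp: S_def)
    ultimately show ?thesis using conn_on_image by metis
  qed
  then show ?thesis
    using assms by (simp add: k_connected_iff pair_graph_image card_image)
qed

lemma num_edges_isomorphic:
  assumes "pair_graph G" "pair_graph H" "isomorphic G H"
  shows "num_edges G = num_edges H"
proof -
  obtain f where f: "inj_on f (pverts G)" "parcs H = map_prod f f ` parcs G"
    using assms(1,3) by (auto simp: isomorphic_iff)
  have "inj_on (map_prod f f) (parcs G)"
    using inj_on_subset[OF map_prod_inj_on[OF f(1) f(1)]] pair_graphD(2)[OF assms(1)] by blast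
  then have "card (parcs H) = card (parcs G)" using f(2) card_image by metis
  then show ?thesis
    using card_arcs[OF pair_graphD(5,3,4)[OF assms(1)]] card_arcs[OF pair_graphD(5,3,4)[OF assms(2)]]
    by (simp add: num_edges_eq)
qed

section \<open>Independent sets of maximum size\<close>

lemma independent_set_card_le:
  assumes "pair_graph G" "independent_set G S"
  shows "card S \<le> independence_number G"
proof -
  have "{card S | S. independent_set G S} \<subseteq> card ` Pow (pverts G)"
    by (auto simp: independent_set_def)
  then have "finite {card S | S. independent_set G S}"
    using pair_graphD(1)[OF assms(1)] finite_subset by blast
  then show ?thesis using assms(2) by (auto simp: independence_number_def intro!: Max_ge)
qed

lemma obtain_max_independent_set:
  assumes "pair_graph G"
  obtains S where "independent_set G S" "card S = independence_number G"
proof -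
  have "{card S | S. independent_set G S} \<subseteq> card ` Pow (pverts G)"
    by (auto simp: independent_set_def)
  then have "finite {card S | S. independent_set G S}"
    using pair_graphD(1)[OF assms(1)] finite_subset by blast
  moreover have "independent_set G {}" by (simp add: independent_set_def)
  ultimately have "independence_number G \<in> {card S | S. independent_set G S}"
    unfolding independence_number_def by (intro Max_in) auto
  then show ?thesis using that by auto
qed

section \<open>Trees\<close>

text \<open>Breadth-first search: each vertex other than the root \<open>r\<close> is joined to a vertex one step
  closer to \<open>r\<close>.\<close>

lemma spanning_tree:
  assumes "finite V" "V \<noteq> {}" "sym E" "conn_on V E"
  obtains T where "T \<subseteq> Restr E V" "sym T" "conn_on V T" "Suc (card (edges T)) = card V"
proof -
  let ?E = "Restr E V"
  obtain r where r: "r \<in> V" using assms(2) by auto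
  define dist where "dist v = (LEAST n. (r, v) \<in> ?E ^^ n)" for v
  have walk: "(r, v) \<in> ?E ^^ dist v" if "v \<in> V" for v
  proof -
    have "(r, v) \<in> ?E\<^sup>*" using assms(4) r that by (auto simp: conn_on_def)
    then show ?thesis unfolding dist_def by (metis (mono_tags, lifting) LeastI rtrancl_imp_relpow)
  qed
  have "\<exists>u. (u, v) \<in> ?E \<and> dist u < dist v" if v: "v \<in> V - {r}" for v
  proof -
    obtain n where n: "dist v = Suc n" using walk[of v] v by (cases "dist v") auto
    then obtain u where u: "(r, u) \<in> ?E ^^ n" "(u, v) \<in> ?E" using walk[of v] v by auto
    have "dist u \<le> n" unfolding dist_def using u(1) by (rule Least_le)
    with u(2) n show ?thesis by auto
  qed
  then obtain p where p: "\<And>v. v \<in> V - {r} \<Longrightarrow> (p v, v) \<in> ?E \<and> dist (p v) < dist v"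
    by metis
  define B where "B = (\<lambda>v. (p v, v)) ` (V - {r})"
  define T where "T = B \<union> B\<inverse>"
  have "B \<subseteq> ?E" using p by (auto simp: B_def)
  then have "T \<subseteq> ?E" using symD[OF assms(3)] by (auto simp: T_def)
  have symT: "sym T" by (auto simp: T_def sym_def)
  have "(r, v) \<in> (Restr T V)\<^sup>*" if "v \<in> V" for v
    using that
  proof (induction "dist v" arbitrary: v rule: less_induct)
    case less
    show ?case
    proof (cases "v = r")
      case False
      then have "(p v, v) \<in> ?E" "dist (p v) < dist v" using p less.prems by auto
      then have "(r, p v) \<in> (Restr T V)\<^sup>*" "(p v, v) \<in> Restr T V"
        using less False by (auto simp: T_def B_def)
      then show ?thesis by (rule rtrancl_into_rtrancl)
    qed simp
  qed
  then have "conn_on V T" using conn_onI_root[OF symT] by blast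
  \<comment> \<open>Otherwise \<open>p v = w\<close> and \<open>p w = v\<close> for distinct
    \<open>v\<close> and \<open>w\<close>, and each would be closer to \<open>r\<close> than the
    other.\<close>
  have "inj_on (\<lambda>v. {p v, v}) (V - {r})"
  proof (rule inj_onI)
    fix v w assume vw: "v \<in> V - {r}" "w \<in> V - {r}" "{p v, v} = {p w, w}"
    then have "dist (p v) < dist v" "dist (p w) < dist w" using p by auto
    with vw(3) show "v = w" by (auto simp: doubleton_eq_iff)
  qed
  moreover have "edges T = (\<lambda>v. {p v, v}) ` (V - {r})"
    unfolding T_def edges_Un_converse by (auto simp: B_def edges_def)
  ultimately have "card (edges T) = card (V - {r})" by (simp add: card_image)
  also have "Suc \<dots> = card V" using r assms(1) by (rule card_Suc_Diff1[rotated])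
  finally show ?thesis using that \<open>T \<subseteq> ?E\<close> symT \<open>conn_on V T\<close> by blast
qed

lemma connected_card_edges:
  assumes "finite V" "V \<noteq> {}" "sym E" "finite E" "conn_on V E"
  shows "card V \<le> Suc (card (edges E))"
proof -
  obtain T where T: "T \<subseteq> Restr E V" "Suc (card (edges T)) = card V"
    using spanning_tree[OF assms(1-3,5)] by metis
  have "card (edges T) \<le> card (edges E)"
    using T(1) assms(4) by (intro card_mono finite_edges edges_mono) auto
  with T(2) show ?thesis by simp
qed

section \<open>Simple paths and cycles\<close>

lemma pcas_rtrancl:
  "pcas x p y \<Longrightarrow> (x, y) \<in> (set p)\<^sup>*"
proof (induction p arbitrary: x)
  case (Cons e p)
  then have "(x, snd e) \<in> set (e # p)" "(snd e, y) \<in> (set p)\<^sup>*" by (cases e; auto)+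
  moreover have "(set p)\<^sup>* \<subseteq> (set (e # p))\<^sup>*" by (intro rtrancl_mono) auto
  ultimately show ?case by (meson converse_rtrancl_into_rtrancl subsetD)
qed simp

lemma set_pawalk_verts:
  "pcas x p y \<Longrightarrow> set (pawalk_verts x p) = insert x (snd ` set p)"
  by (induction p arbitrary: x) auto

lemma fst_in_pawalk_verts:
  "e \<in> set p \<Longrightarrow> fst e \<in> set (pawalk_verts x p)"
  by (induction p arbitrary: x) auto

lemma last_pawalk_verts:
  "pcas x p y \<Longrightarrow> last (pawalk_verts x p) = y"
proof (induction p arbitrary: x)
  case (Cons e p)
  moreover have "pawalk_verts (snd e) p \<noteq> []" by (cases p) auto
  ultimately show ?case by simp
qed simp

text \<open>The path grows backwards from \<open>y\<close>. If the new first vertex \<open>x\<close>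
  already occurs on it, everything before that occurrence is dropped (\<open>cut\<close>), so no
  vertex is ever repeated.\<close>

lemma pcas_rtranclE:
  assumes "(x, y) \<in> E\<^sup>*"
  obtains p where "pcas x p y" "set p \<subseteq> E" "distinct (pawalk_verts x p)"
proof -
  have "\<exists>p. pcas x p y \<and> set p \<subseteq> E \<and> distinct (pawalk_verts x p)"
    using assms
  proof (induction rule: converse_rtrancl_induct)
    case base
    show ?case by (rule exI[of _ "[]"]) auto
  next
    case (step x z)
    then obtain p where p: "pcas z p y" "set p \<subseteq> E" "distinct (pawalk_verts z p)" by blast
    have cut: "\<exists>q. pcas x q y \<and> set q \<subseteq> set p \<and> distinct (pawalk_verts x q)"
      if "x \<in> set (pawalk_verts z p)" using that p(1,3)
    proof (induction p arbitrary: z)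
      case Nil
      then show ?case by (intro exI[of _ "[]"]) auto
    next
      case (Cons e p)
      show ?case
      proof (cases "x = z")
        case True
        then show ?thesis using Cons.prems by blast
      next
        case False
        then have "\<exists>q. pcas x q y \<and> set q \<subseteq> set p \<and> distinct (pawalk_verts x q)"
          using Cons.prems by (intro Cons.IH[of "snd e"]) auto
        then show ?thesis by auto
      qed
    qed
    show ?case
    proof (cases "x \<in> set (pawalk_verts z p)")
      case True
      then show ?thesis using cut p(2) by blast
    next
      case False
      then show ?thesis using p step.hyps(1) by (intro exI[of _ "(x, z) # p"]) auto
    qed
  qed
  then show ?thesis using that by blast
qed

text \<open>Every passage through the deleted edge can be rerouted along a path that still joins its
  ends.\<close>

lemma conn_on_delete_edge:
  assumes "sym E" "conn_on V E" "(v, u) \<in> (Restr (E - {(u, v), (v, u)}) V)\<^sup>*"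
  shows "conn_on V (E - {(u, v), (v, u)})"
proof -
  let ?F = "E - {(u, v), (v, u)}"
  have "sym ?F" using assms(1) unfolding sym_def by blast
  then have "(u, v) \<in> (Restr ?F V)\<^sup>*" using assms(3) conn_on_sym by metis
  then have "Restr E V \<subseteq> (Restr ?F V)\<^sup>*" using assms(3) by auto
  then have "(Restr E V)\<^sup>* \<subseteq> (Restr ?F V)\<^sup>*" by (rule rtrancl_subset_rtrancl)
  then show ?thesis using assms(2) unfolding conn_on_def by blast
qed

lemma edges_delete_edge:
  "edges (E - {(u, v), (v, u)}) = edges E - {{u, v}}"
proof -
  have "(\<lambda>(u, v). {u, v}) a = {u, v} \<longleftrightarrow> a \<in> {(u, v), (v, u)}" for a
    by (cases a) (auto simp: doubleton_eq_iff)
  then have "E - {(u, v), (v, u)} = {a \<in> E. (\<lambda>(u, v). {u, v}) a \<noteq> {u, v}}"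
    by (intro set_eqI) (simp only: Diff_iff mem_Collect_eq)
  moreover have "f ` {a \<in> E. f a \<noteq> c} = f ` E - {c}" for f :: "'a \<times> 'a \<Rightarrow> 'a set" and c
    by auto
  ultimately show ?thesis by (simp only: edges_def)
qed

lemma cycle_iff:
  "pre_digraph.cycle (with_proj G) p \<longleftrightarrow> (\<exists>u \<in> pverts G. set p \<subseteq> parcs G \<and> pcas u p u \<and>
     distinct (tl (pawalk_verts u p)) \<and> p \<noteq> [])"
  by (auto simp: pre_digraph.cycle_def pre_digraph.awalk_def cas_with_proj_eq
      awalk_verts_with_proj_eq)

text \<open>An edge on a cycle can be deleted without disconnecting the graph, so a connected graph
  with a cycle has at least as many edges as vertices. Conversely, an edge outside a spanning tree
  closes a cycle with the tree path between its ends.\<close>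

lemma undirected_tree_iff:
  assumes "pair_graph G" "pverts G \<noteq> {}"
  shows "undirected_tree G \<longleftrightarrow>
    conn_on (pverts G) (parcs G) \<and> Suc (num_edges G) = card (pverts G)"
proof -
  note G = pair_graphD[OF assms(1)]
  let ?V = "pverts G" and ?E = "parcs G"
  have restr: "Restr F ?V = F" if "F \<subseteq> ?E" for F using that G(2) by auto
  have "Suc (num_edges G) \<noteq> card ?V"
    if conn: "conn_on ?V ?E" and p: "pre_digraph.cycle (with_proj G) p" "3 \<le> length p" for p
  proof -
    from p(1) obtain u where u: "set p \<subseteq> ?E" "pcas u p u" "distinct (tl (pawalk_verts u p))"
      by (auto simp: cycle_iff)
    obtain a b q where abq: "p = a # b # q" "q \<noteq> []"
      using p(2) by (cases p; cases "tl p"; cases "tl (tl p)") auto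
    define v x where "v = snd a" and "x = snd b"
    have a: "a = (u, v)" and b: "b = (v, x)" using u(2) abq by (auto simp: v_def x_def prod_eq_iff)
    have q: "pcas x q u" "distinct (pawalk_verts x q)" "v \<notin> set (pawalk_verts x q)"
      using u(2,3) abq by (auto simp: a b)
    \<comment> \<open>The second arc is not the first one reversed. This uses length at least 3: the
      nonempty simple path \<open>q\<close> ends in \<open>u\<close> and so cannot start
      there.\<close>
    have "x \<noteq> u"
    proof
      assume "x = u"
      obtain c q' where c: "q = c # q'" using abq(2) by (cases q) auto
      have "last (pawalk_verts (snd c) q') = u" using q(1) c by (auto simp: last_pawalk_verts)
      moreover have "pawalk_verts (snd c) q' \<noteq> []" by (cases q') auto
      ultimately have "u \<in> set (pawalk_verts (snd c) q')" by (metis last_in_set)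
      then show False using q(1,2) c \<open>x = u\<close> by auto
    qed
    let ?F = "?E - {(u, v), (v, u)}"
    have symF: "sym ?F" using G(3) unfolding sym_def by blast
    \<comment> \<open>\<open>q\<close> avoids \<open>v\<close>, so it uses the deleted edge in
      neither direction.\<close>
    have "set q \<subseteq> ?F"
      using u(1) abq q(3) fst_in_pawalk_verts[of _ q x] set_pawalk_verts[OF q(1)]
      by (force simp: image_iff)
    then have "(x, u) \<in> ?F\<^sup>*" using pcas_rtrancl[OF q(1)] rtrancl_mono by blast
    moreover have "(v, x) \<in> ?F" using u(1) abq b \<open>x \<noteq> u\<close> G(4) by (auto simp: irrefl_def)
    ultimately have "(v, u) \<in> ?F\<^sup>*" by (meson converse_rtrancl_into_rtrancl)
    then have "conn_on ?V ?F" using conn_on_delete_edge[OF G(3) conn] restr[of ?F] by auto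
    then have "card ?V \<le> Suc (card (edges ?F))"
      using G(1,5) assms(2) symF by (intro connected_card_edges) auto
    moreover have "{u, v} \<in> edges ?E" using u(1) abq a by (force simp: edges_def)
    then have "card (edges ?F) < card (edges ?E)"
      unfolding edges_delete_edge using finite_edges[OF G(5)] by (metis card_Diff1_less)
    ultimately show ?thesis by (simp add: num_edges_eq)
  qed
  moreover have "\<exists>p. pre_digraph.cycle (with_proj G) p \<and> 3 \<le> length p"
    if conn: "conn_on ?V ?E" and ne: "Suc (num_edges G) \<noteq> card ?V"
  proof -
    obtain T where "T \<subseteq> Restr ?E ?V"
      and T': "sym T" "conn_on ?V T" "Suc (card (edges T)) = card ?V"
      by (rule spanning_tree[OF G(1) assms(2) G(3) conn])
    then have T: "T \<subseteq> ?E" "sym T" "conn_on ?V T" "Suc (card (edges T)) = card ?V" by auto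
    then have "T \<noteq> ?E" using ne by (auto simp: num_edges_eq)
    then obtain u v where uv: "(u, v) \<in> ?E" "(u, v) \<notin> T" using T(1) by auto
    then have "(v, u) \<in> T\<^sup>*" using T(3) G(2) restr[OF T(1)] by (auto simp: conn_on_def)
    then obtain q where q: "pcas v q u" "set q \<subseteq> T" "distinct (pawalk_verts v q)"
      by (rule pcas_rtranclE)
    have "u \<noteq> v" using uv G(4) by (auto simp: irrefl_def)
    moreover have "(v, u) \<notin> T" using uv(2) T(2) by (meson symD)
    \<comment> \<open>Length 0 would give \<open>u = v\<close>, and length 1 would put the missing
      edge into \<open>T\<close>.\<close>
    ultimately have "2 \<le> length q" using q(1,2) by (cases q; cases "tl q") (auto simp: prod_eq_iff)
    then have "3 \<le> length ((u, v) # q)" by simp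
    moreover have "pre_digraph.cycle (with_proj G) ((u, v) # q)"
      unfolding cycle_iff using q T(1) uv(1) G(2) by (intro bexI[of _ u]) auto
    ultimately show ?thesis by blast
  qed
  ultimately show ?thesis
    unfolding undirected_tree_def connected_iff[OF assms(1)] using assms(2) by blast
qed

section \<open>Harary graphs\<close>

text \<open>Starting at \<open>a\<close>, jump to any free position within distance
  \<open>r\<close>. The walk gets stuck only in front of \<open>r\<close> consecutive deleted
  positions, and these exhaust the deletions allowed between \<open>a\<close> and
  \<open>b\<close>.\<close>

lemma walk_or_run:
  fixes D :: "int set" and r :: nat
  assumes trans: "transp R"
    and step: "\<forall>x y. x \<notin> D \<longrightarrow> y \<notin> D \<longrightarrow> x < y \<longrightarrow> y \<le> x + int r \<longrightarrow> R x y"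
    and "0 < r" "a < b" "a \<notin> D" "b \<notin> D" "card (D \<inter> {a<..<b}) \<le> r"
  shows "R a b \<or> (\<exists>p>a. p + int r \<le> b \<and> D \<inter> {a<..<b} = {p..<p + int r})"
  using assms(4-7)
proof (induction "nat (b - a)" arbitrary: a rule: less_induct)
  case less
  note trans = transpD[OF trans] and step = step[rule_format]
  consider "b \<le> a + int r" | c where "b > a + int r" "c \<in> {a<..a + int r}" "c \<notin> D"
    | "b > a + int r" "{a<..a + int r} \<subseteq> D"
    by fastforce
  then show ?case
  proof cases
    case 1
    then show ?thesis using step less.prems by blast
  next
    case 2
    then have ac: "R a c" and cb: "c < b" "a < c" using step less.prems by auto
    have sub: "D \<inter> {c<..<b} \<subseteq> D \<inter> {a<..<b}" using cb by auto
    then have "card (D \<inter> {c<..<b}) \<le> r"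
      using less.prems(4) card_mono[OF _ sub] by simp
    then have "R c b \<or> (\<exists>p>c. p + int r \<le> b \<and> D \<inter> {c<..<b} = {p..<p + int r})"
      using less.hyps[of c] cb 2 less.prems by auto
    then show ?thesis
    proof
      assume "R c b"
      then show ?thesis using trans ac by blast
    next
      assume "\<exists>p>c. p + int r \<le> b \<and> D \<inter> {c<..<b} = {p..<p + int r}"
      then obtain p where p: "p > c" "p + int r \<le> b" "D \<inter> {c<..<b} = {p..<p + int r}" by blast
      \<comment> \<open>The run found beyond \<open>c\<close> already has \<open>r\<close> elements,
        so nothing else in the larger interval is deleted.\<close>
      then have "D \<inter> {a<..<b} = {p..<p + int r}"
        using less.prems(4) card_seteq[OF _ sub] by simp
      then show ?thesis using p cb by (intro disjI2 exI[of _ p]) auto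
    qed
  next
    case 3
    then have "{a + 1..<a + 1 + int r} \<subseteq> D \<inter> {a<..<b}" by auto
    then have "{a + 1..<a + 1 + int r} = D \<inter> {a<..<b}"
      using less.prems(4) by (intro card_seteq) auto
    then show ?thesis using 3 by (intro disjI2 exI[of _ "a + 1"]) auto
  qed
qed

text \<open>Fewer than \<open>r\<close> deletions cannot contain a blocking run.\<close>

lemma walk:
  fixes D :: "int set" and r :: nat
  assumes trans: "transp R"
    and step: "\<forall>x y. x \<notin> D \<longrightarrow> y \<notin> D \<longrightarrow> x < y \<longrightarrow> y \<le> x + int r \<longrightarrow> R x y"
    and "a < b" "a \<notin> D" "b \<notin> D" "card (D \<inter> {a<..<b}) < r"
  shows "R a b"
proof (rule ccontr)
  assume "\<not> R a b"
  then obtain p where "D \<inter> {a<..<b} = {p..<p + int r}"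
    using walk_or_run[OF trans step, of a b] assms(3-6) by fastforce
  then show False using assms(6) by simp
qed

text \<open>The vertices of a circulant graph are unrolled to the integers: \<open>D\<close> is the periodic set of
  deleted positions and \<open>R\<close> is connectedness of positions. The last assumption describes the
  diameters, which are present when the connectivity \<open>2 * r + 1\<close> is odd. Of the two arcs between
  \<open>u\<close> and \<open>w\<close> one can be walked unless both contain a run of exactly \<open>r\<close> deleted positions and
  nothing else is deleted; then a diameter at the end of the shorter remaining segment leads to the
  other segment.\<close>

lemma circular_walk:
  fixes D :: "int set" and r n m :: nat
  assumes trans: "transp R"
    and sym: "symp R"
    and refl: "reflp R"
    and shift: "\<And>x y. R x (y + int n) \<longleftrightarrow> R x y"
    and period: "\<And>x. x + int n \<in> D \<longleftrightarrow> x \<in> D"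
    and step: "\<forall>x y. x \<notin> D \<longrightarrow> y \<notin> D \<longrightarrow> x < y \<longrightarrow> y \<le> x + int r \<longrightarrow> R x y"
    and r: "0 < r"
    and uw: "u < w" "w < u + int n" "u \<notin> D" "w \<notin> D"
    and card: "card (D \<inter> {u..<u + int n}) < 2 * r \<or>
      card (D \<inter> {u..<u + int n}) \<le> 2 * r \<and> m = n div 2 \<and> r < m \<and>
      (\<forall>x. x \<notin> D \<longrightarrow> (\<exists>y \<in> {x + int m, x + int n - int m}. y \<notin> D \<longrightarrow> R x y))"
  shows "R u w"
proof -
  note sym = sympD[OF sym] and refl = reflpD[OF refl] and transD = transpD[OF trans]
  \<comment> \<open>The deletions on the two arcs of the circle; \<open>u + int n\<close> is
    \<open>u\<close> after one full turn.\<close>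
  let ?A = "D \<inter> {u<..<w}" and ?B = "D \<inter> {w<..<u + int n}"
  have "D \<inter> {u..<u + int n} = ?A \<union> ?B" using uw by (auto simp: order.order_iff_strict) (metis linorder_cases)
  then have AB: "card (D \<inter> {u..<u + int n}) = card ?A + card ?B"
    by (simp add: card_Un_disjoint Int_assoc disjoint_iff)
  have un: "u + int n \<notin> D" using period uw by blast
  have wrap: "R u w" if "R w (u + int n)" using that shift sym by blast
  have less: ?thesis if "card ?A < r \<or> card ?B < r"
    using that walk[OF trans step, of u w] walk[OF trans step, of w "u + int n"]
      uw un wrap by blast
  show ?thesis
  proof (cases "card ?A < r \<or> card ?B < r")
    case True
    then show ?thesis by (rule less)
  next
    case False
    \<comment> \<open>Each arc has at least \<open>r\<close> deletions, which refutes the first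
      alternative of \<open>card\<close>; the bound \<open>2 * r\<close> of the second leaves
      exactly \<open>r\<close> for each.\<close>
    then have cards: "card ?A = r" "card ?B = r" and m: "m = n div 2" "r < m"
      and chord: "\<And>x. x \<notin> D \<Longrightarrow> \<exists>y \<in> {x + int m, x + int n - int m}. y \<notin> D \<longrightarrow> R x y"
      using AB card by auto
    show ?thesis
    proof (rule ccontr)
      assume not: "\<not> R u w"
      obtain p where p: "p > u" "p + int r \<le> w" "?A = {p..<p + int r}"
        using walk_or_run[OF trans step, of u w] cards r uw not by auto
      obtain q where q: "q > w" "q + int r \<le> u + int n" "?B = {q..<q + int r}"
        using walk_or_run[OF trans step, of w "u + int n"] cards r uw un not wrap by auto
      \<comment> \<open>The free positions form two segments: around \<open>u\<close> from
        \<open>q + int r - int n\<close> up to \<open>p\<close>, and around \<open>w\<close> from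
        \<open>p + int r\<close> up to \<open>q\<close>. The third disjunct is the segment around
        \<open>u\<close> one turn later.\<close>
      have free: "x \<notin> D"
        if "q + int r \<le> x + int n \<and> x < p \<or> p + int r \<le> x \<and> x < q
          \<or> q + int r \<le> x \<and> x < p + int n" for x
      proof
        assume x: "x \<in> D"
        then have x': "x + int n \<in> D" "x - int n \<in> D" using period[of x] period[of "x - int n"] by auto
        have A: "y \<le> u \<or> w \<le> y \<or> p \<le> y \<and> y < p + int r" if "y \<in> D" for y
          using that p(3) by (metis Int_iff greaterThanLessThan_iff atLeastLessThan_iff not_le)
        have B: "y \<le> w \<or> u + int n \<le> y \<or> q \<le> y \<and> y < q + int r" if "y \<in> D" for y
          using that q(3) by (metis Int_iff greaterThanLessThan_iff atLeastLessThan_iff not_le)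
        have ne: "x \<noteq> u" "x \<noteq> w" "x \<noteq> u + int n" using x uw un by auto
        from that show False
        proof (elim disjE conjE)
          assume "q + int r \<le> x + int n" "x < p"
          then show False
            using A[OF x] B[OF x'(1)] p(1,2) q(1,2) uw(1,2) r ne(1) by linarith
        next
          assume "p + int r \<le> x" "x < q"
          then show False
            using A[OF x] B[OF x] p(1,2) q(1,2) uw(1,2) r ne(2) by linarith
        next
          assume "q + int r \<le> x" "x < p + int n"
          then show False
            using B[OF x] A[OF x'(2)] p(1,2) q(1,2) uw(1,2) r ne(3) by linarith
        qed
      qed
      have near: "R x y" if "x \<le> y" "x \<notin> D" "y \<notin> D" "D \<inter> {x<..<y} = {}" for x y
        using that walk[OF trans step, of x y] r refl by (cases "x = y") auto
      have left: "R u x" if x: "q + int r \<le> x + int n" "x < p" for x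
      proof -
        have e: "D \<inter> {x<..<u} = {}" "D \<inter> {u<..<x} = {}" using free x p q by auto
        have "x \<notin> D" using free x by blast
        then show ?thesis using near[of u x] near[of x u] sym uw e by (cases "u \<le> x") auto
      qed
      have right: "R w x" if x: "p + int r \<le> x" "x < q" for x
      proof -
        have e: "D \<inter> {x<..<w} = {}" "D \<inter> {w<..<x} = {}" using free x p q by auto
        have "x \<notin> D" using free x by blast
        then show ?thesis using near[of w x] near[of x w] sym uw e by (cases "w \<le> x") auto
      qed
      show False
      \<comment> \<open>The segment around \<open>u\<close> has
        \<open>int n - (q - p) - int r\<close> positions, the one around \<open>w\<close> has
        \<open>q - p - int r\<close>. The diameter is taken at the first position of a segment that
        is not the longer one.\<close>
      proof (cases "int n \<le> 2 * (q - p)")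
        case True
        define x where "x = q + int r - int n"
        have "x < p" using p q uw by (simp add: x_def)
        then have x: "x \<notin> D" "R u x" using free left by (auto simp: x_def)
        obtain y where y: "y \<in> {x + int m, x + int n - int m}" "y \<notin> D \<longrightarrow> R x y"
          using chord x(1) by blast
        \<comment> \<open>Both candidates for \<open>y\<close> fall into the segment around
          \<open>w\<close>: the case condition gives the lower bound, \<open>r < m\<close> the upper
          one.\<close>
        then have "p + int r \<le> y" "y < q" using True m by (auto simp: x_def)
        then have "R w y" "R x y" using right free y by auto
        then show False using not x(2) transD sym by blast
      next
        case False
        define x where "x = p + int r"
        have "x < q" using p q by (simp add: x_def)
        then have x: "x \<notin> D" "R w x" using free right by (auto simp: x_def)
        obtain y where y: "y \<in> {x + int m, x + int n - int m}" "y \<notin> D \<longrightarrow> R x y"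
          using chord x(1) by blast
        \<comment> \<open>Here \<open>y\<close> falls into the segment around \<open>u\<close> one
          turn later, so \<open>y - int n\<close> lies in the original one.\<close>
        then have "q + int r \<le> y" "y < p + int n" using False m by (auto simp: x_def)
        then have "R u (y - int n)" "R x y" using left free y by auto
        then have "R u y" using shift[of u "y - int n"] by simp
        then show False using not x(2) \<open>R x y\<close> transD sym by blast
      qed
    qed
  qed
qed

text \<open>Harary's construction, with edges listed in one direction: jumps of length at most
  \<open>d div 2\<close> around a circle and, for odd \<open>d\<close>, diameters. For odd
  \<open>n\<close> the vertex \<open>n div 2\<close> lies on two diameters, every other vertex on
  one.\<close>

definition harary_arcs :: "nat \<Rightarrow> nat \<Rightarrow> nat rel" where
  "harary_arcs n d =
     (\<lambda>(x, j). (x, (x + j) mod n)) ` ({..<n} \<times> {1..d div 2}) \<union>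
     (if odd d then (\<lambda>x. (x, x + n div 2)) ` {..<(n + 1) div 2} else {})"

definition harary :: "nat \<Rightarrow> nat \<Rightarrow> nat pair_pre_digraph" where
  "harary n d = \<lparr>pverts = {..<n}, parcs = harary_arcs n d \<union> (harary_arcs n d)\<inverse>\<rparr>"

lemma pair_graph_harary:
  assumes "d < n" "2 \<le> n"
  shows "pair_graph (harary n d)"
proof -
  have "(x + j) mod n \<noteq> x" if "x < n" "Suc 0 \<le> j" "j \<le> d div 2" for x j
    using that assms by (cases "x + j < n") (auto simp: mod_if)
  moreover have "n div 2 \<noteq> 0" using assms(2) by simp
  ultimately have "(x, x) \<notin> harary_arcs n d" for x
    unfolding harary_arcs_def by (auto split: if_splits) (metis)+
  then have "irrefl (harary_arcs n d)" by (simp add: irrefl_def)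
  then have "irrefl (harary_arcs n d \<union> (harary_arcs n d)\<inverse>)" by (auto simp: irrefl_def)
  moreover have "harary_arcs n d \<subseteq> {..<n} \<times> {..<n}"
    using assms by (auto simp: harary_arcs_def)
  ultimately show ?thesis
    by (auto simp: pair_graph_iff harary_def sym_Un_converse)
qed

text \<open>Counting generators gives only an upper bound, since coincidences are not excluded; the
  reverse inequality comes from the degrees through \<open>min_size_le\<close>.\<close>

lemma num_edges_harary: "num_edges (harary n d) \<le> (n * d + 1) div 2"
proof -
  let ?A = "(\<lambda>(x, j). (x, (x + j) mod n)) ` ({..<n} \<times> {1..d div 2})"
  let ?C = "if odd d then (\<lambda>x. (x, x + n div 2)) ` {..<(n + 1) div 2} else {}"
  have "num_edges (harary n d) = card (edges (harary_arcs n d))"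
    by (simp add: num_edges_eq harary_def edges_Un_converse)
  also have "\<dots> \<le> card (harary_arcs n d)"
    unfolding edges_def by (rule card_image_le) (simp add: harary_arcs_def)
  also have "\<dots> \<le> card ?A + card ?C" unfolding harary_arcs_def by (rule card_Un_le)
  also have "card ?A \<le> n * (d div 2)"
    by (rule order_trans[OF card_image_le]) auto
  also have "card ?C \<le> (if odd d then (n + 1) div 2 else 0)"
    using card_image_le[of "{..<(n + 1) div 2}" "\<lambda>x. (x, x + n div 2)"] by simp
  also have "n * (d div 2) + (if odd d then (n + 1) div 2 else 0) = (n * d + 1) div 2"
  proof (cases "odd d")
    case True
    then obtain r where "d = 2 * r + 1" by (rule oddE)
    moreover have "(n * (2 * r + 1) + 1) div 2 = (2 * (n * r) + (n + 1)) div 2"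
      by (simp add: algebra_simps)
    ultimately show ?thesis by simp
  next
    case False
    then obtain r where "d = 2 * r" by (auto elim: evenE)
    moreover have "(n * (2 * r) + 1) div 2 = (2 * (n * r) + 1) div 2"
      by (simp add: algebra_simps)
    ultimately show ?thesis by simp
  qed
  finally show ?thesis by simp
qed

text \<open>If \<open>d = 2 * r\<close>, fewer than \<open>2 * r\<close> vertices are deleted; if
  \<open>d = 2 * r + 1\<close>, at most \<open>2 * r\<close> are deleted and diameters are
  available. These are the two alternatives of \<open>circular_walk\<close>.\<close>

lemma k_connected_harary:
  assumes "2 \<le> d" "d < n"
  shows "k_connected d (harary n d)"
proof -
  let ?E = "parcs (harary n d)" and ?r = "d div 2" and ?m = "n div 2"
  have G: "pair_graph (harary n d)" using pair_graph_harary assms by simp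
  note symE = pair_graphD(3)[OF G]
  have n: "int n > 0" using assms by simp
  have "conn_on ({..<n} - S) ?E" if S: "S \<subseteq> {..<n}" "card S < d" for S
  proof -
    let ?W = "{..<n} - S"
    \<comment> \<open>\<open>pos\<close> reads an integer position modulo \<open>n\<close>;
      \<open>D\<close> and \<open>R\<close> pull deletion and connectedness in the remaining graph
      back along it.\<close>
    define pos where "pos x = nat (x mod int n)" for x
    define D where "D = {x. pos x \<in> S}"
    define R where "R x y \<longleftrightarrow> (pos x, pos y) \<in> (Restr ?E ?W)\<^sup>*" for x y
    have int_pos: "int (pos x) = x mod int n" for x using n by (simp add: pos_def)
    have pos_lt: "pos x < n" for x using int_pos[of x] n pos_mod_bound[of "int n" x] by linarith
    have pos_eqI: "pos y = z" if "y mod int n = int z" for y z using that by (simp add: pos_def)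
    have pos_nat: "pos (int a) = a" if "a < n" for a using that by (intro pos_eqI) simp
    have arc: "R x y" if "x \<notin> D" "y \<notin> D" "(pos x, pos y) \<in> ?E" for x y
      using that pos_lt by (auto simp: R_def D_def)
    have trans: "transp R" unfolding R_def by (meson transpI rtrancl_trans)
    have sym: "symp R" unfolding R_def by (rule sympI) (rule conn_on_sym[OF symE])
    have refl: "reflp R" by (simp add: reflp_def R_def)
    have shift: "R x (y + int n) \<longleftrightarrow> R x y" for x y by (simp add: R_def pos_def)
    have period: "x + int n \<in> D \<longleftrightarrow> x \<in> D" for x by (simp add: D_def pos_def)
    have step: "\<forall>x y. x \<notin> D \<longrightarrow> y \<notin> D \<longrightarrow> x < y \<longrightarrow> y \<le> x + int ?r \<longrightarrow> R x y"
    proof (intro allI impI)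
      fix x y assume xy: "x \<notin> D" "y \<notin> D" "x < y" "y \<le> x + int ?r"
      define j where "j = nat (y - x)"
      have j: "y = x + int j" "j \<in> {1..?r}" using xy by (auto simp: j_def)
      have "pos y = (pos x + j) mod n"
        by (rule pos_eqI) (simp add: j int_pos zmod_int mod_add_left_eq)
      then have "(pos x, pos y) \<in> harary_arcs n d"
        using j(2) pos_lt[of x] by (force simp: harary_arcs_def)
      then show "R x y" using arc xy by (auto simp: harary_def)
    qed
    have chord: "\<exists>y \<in> {x + int ?m, x + int n - int ?m}. y \<notin> D \<longrightarrow> R x y" if "odd d" "x \<notin> D" for x
    \<comment> \<open>Vertices below \<open>(n + 1) div 2\<close> start a diameter. The others end
      one, and their partner \<open>?m\<close> steps back is written one turn later.\<close>
    proof (cases "pos x < (n + 1) div 2")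
      case True
      then have "pos x + ?m < n" by linarith
      then have "pos (x + int ?m) = pos x + ?m"
        by (intro pos_eqI) (metis int_pos mod_add_left_eq mod_less of_nat_add zmod_int)
      then have "(pos x, pos (x + int ?m)) \<in> harary_arcs n d"
        using True that(1) by (auto simp: harary_arcs_def)
      then show ?thesis using arc that(2) by (auto simp: harary_def)
    next
      case False
      then have le: "?m \<le> pos x" by linarith
      have "(x + int n - int ?m) mod int n = ((x - int ?m) + int n) mod int n"
        by (simp only: add.commute add_diff_eq)
      also have "\<dots> = (x mod int n - int ?m) mod int n"
        by (simp only: mod_add_self2 mod_diff_left_eq)
      also have "\<dots> = int (pos x - ?m) mod int n" using le by (simp add: int_pos[symmetric] of_nat_diff)
      also have "\<dots> = int (pos x - ?m)" using pos_lt[of x] by simp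
      finally have eq: "pos (x + int n - int ?m) = pos x - ?m" by (rule pos_eqI)
      have "pos x - ?m < (n + 1) div 2" using pos_lt[of x] by linarith
      then have "(pos x - ?m, pos x) \<in> harary_arcs n d"
        using le that(1) by (auto simp: harary_arcs_def image_iff)
      then have "(pos x, pos (x + int n - int ?m)) \<in> ?E" by (simp add: eq harary_def)
      then show ?thesis using arc that(2) by blast
    qed
    \<comment> \<open>A window of length \<open>n\<close> meets each residue class only
      once.\<close>
    have card: "card (D \<inter> {u..<u + int n}) \<le> card S" for u
    proof (rule card_inj_on_le)
      show "inj_on pos (D \<inter> {u..<u + int n})"
      proof (rule inj_onI)
        fix x y assume xy: "x \<in> D \<inter> {u..<u + int n}" "y \<in> D \<inter> {u..<u + int n}" "pos x = pos y"
        then have "x mod int n = y mod int n" by (metis int_pos)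
        then have "int n dvd x - y" by (simp add: mod_eq_dvd_iff)
        moreover have "\<bar>x - y\<bar> < int n" using xy(1,2) by auto
        ultimately show "x = y" using zdvd_imp_le[of "int n" "\<bar>x - y\<bar>"] by auto
      qed
      show "finite S" using S(1) finite_subset by blast
    qed (auto simp: D_def)
    have "R (int a) (int b)" if ab: "a \<in> ?W" "b \<in> ?W" "a < b" for a b
    proof (rule circular_walk[OF trans sym refl shift period step])
      show "0 < ?r" using assms(1) by simp
      show "int a \<notin> D" "int b \<notin> D" using ab by (auto simp: D_def pos_nat)
      show "int a < int b" "int b < int a + int n" using ab by auto
      show "card (D \<inter> {int a..<int a + int n}) < 2 * ?r \<or>
        card (D \<inter> {int a..<int a + int n}) \<le> 2 * ?r \<and> ?m = n div 2 \<and> ?r < ?m \<and>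
        (\<forall>x. x \<notin> D \<longrightarrow> (\<exists>y \<in> {x + int ?m, x + int n - int ?m}. y \<notin> D \<longrightarrow> R x y))"
      proof (cases "odd d")
        case True
        then obtain r where "d = 2 * r + 1" by (rule oddE)
        then have "?r = r" "card S \<le> 2 * r" "r < ?m" using S(2) assms(2) by auto
        then show ?thesis using card[of "int a"] chord True by auto
      next
        case False
        then have "2 * ?r = d" by simp
        then show ?thesis using card[of "int a"] S(2) by linarith
      qed
    qed
    then have "(a, b) \<in> (Restr ?E ?W)\<^sup>*" if "a \<in> ?W" "b \<in> ?W" "a < b" for a b
      using that by (auto simp: R_def pos_nat)
    then show ?thesis unfolding conn_on_def
      by (metis conn_on_sym[OF symE] linorder_neqE_nat rtrancl.rtrancl_refl)
  qed
  then show ?thesis using assms(2) by (simp add: k_connected_iff[OF G]) (simp add: harary_def)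
qed

section \<open>Joins with an edgeless graph\<close>

definition induce :: "'a pair_pre_digraph \<Rightarrow> 'a set \<Rightarrow> 'a pair_pre_digraph" where
  "induce G W = \<lparr>pverts = W, parcs = Restr (parcs G) W\<rparr>"

lemma induce_simps [simp]:
  "pverts (induce G W) = W" "parcs (induce G W) = Restr (parcs G) W"
  by (simp_all add: induce_def)

lemma pair_graph_induce:
  assumes "pair_graph G" "W \<subseteq> pverts G"
  shows "pair_graph (induce G W)"
proof -
  note G = pair_graphD[OF assms(1)]
  have "sym (Restr (parcs G) W)" using G(3) unfolding sym_def by blast
  moreover have "finite W" using G(1) assms(2) finite_subset by blast
  ultimately show ?thesis using G(4) by (auto simp: pair_graph_iff irrefl_def)
qed

lemma conn_on_Restr: "X \<subseteq> W \<Longrightarrow> conn_on X (Restr E W) \<longleftrightarrow> conn_on X E"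
proof -
  assume "X \<subseteq> W"
  then have "Restr (Restr E W) X = Restr E X" by blast
  then show ?thesis by (simp add: conn_on_def)
qed

text \<open>The join in internal form: \<open>G\<close> itself splits into \<open>S\<close> and the
  rest, with no isomorphic copy on a sum type.\<close>

locale edgeless_join =
  fixes G :: "'a pair_pre_digraph" and S :: "'a set"
  assumes graph: "pair_graph G"
    and indep: "independent_set G S"
    and complete: "S \<times> (pverts G - S) \<subseteq> parcs G"
begin

abbreviation "W \<equiv> pverts G - S"
abbreviation "H \<equiv> induce G W"

lemmas G = pair_graphD[OF graph]

lemma S_sub: "S \<subseteq> pverts G" and S_free: "Restr (parcs G) S = {}"
  using indep by (auto simp: independent_set_def)

lemma finite_parts: "finite S" "finite W"
  using G(1) S_sub finite_subset by auto

lemma card_verts: "card (pverts G) = card S + card W"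
  using G(1) S_sub by (metis card_Diff_subset card_mono finite_parts(1) le_add_diff_inverse)

lemma graph_H: "pair_graph H"
  by (rule pair_graph_induce[OF graph]) blast

lemma complete': "W \<times> S \<subseteq> parcs G"
  using complete G(3) unfolding sym_def by blast

lemma num_edges_join: "num_edges G = card S * card W + num_edges H"
  using card_edges_split[OF G(1) S_sub S_free G(2,3,4) complete] by (simp add: num_edges_eq)

text \<open>If the deleted set \<open>T\<close> contains \<open>S\<close>, fewer than
  \<open>d\<close> vertices of \<open>H\<close> are lost. Otherwise some \<open>z\<close> in
  \<open>S\<close> survives, and so does some \<open>y\<close> in \<open>W\<close> because
  \<open>card T < card W\<close>; \<open>z\<close> reaches \<open>W\<close> directly and the rest of
  \<open>S\<close> through \<open>y\<close>.\<close>

lemma k_connected_joinI: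
  assumes "S \<noteq> {}" "card W = card S + d" "k_connected d H"
  shows "k_connected (card W) G"
proof -
  have "conn_on (pverts G - T) (parcs G)" if T: "T \<subseteq> pverts G" "card T < card W" for T
  proof (cases "S \<subseteq> T")
    case True
    have "finite T" using T(1) G(1) finite_subset by blast
    then have "card T = card S + card (T - S)"
      using True by (metis card_Diff_subset card_mono finite_parts(1) le_add_diff_inverse)
    then have "card (T - S) < d" "T - S \<subseteq> W" using T assms(2) by auto
    then have "conn_on (W - (T - S)) (parcs H)"
      using assms(3) unfolding k_connected_iff[OF graph_H] induce_simps by blast
    moreover have "W - (T - S) = pverts G - T" using True by blast
    ultimately show ?thesis using True conn_on_Restr[of "pverts G - T" W] by auto
  next
    case False
    then obtain z where z: "z \<in> S" "z \<notin> T" by blast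
    have "finite T" using T(1) G(1) finite_subset by blast
    then have "\<not> W \<subseteq> T" using T(2) card_mono[of T W] by auto
    then obtain y where y: "y \<in> W" "y \<notin> T" by blast
    let ?R = "Restr (parcs G) (pverts G - T)"
    show ?thesis
    proof (rule conn_onI_root[OF G(3), of _ z])
      fix v assume v: "v \<in> pverts G - T"
      show "(z, v) \<in> ?R\<^sup>*"
      proof (cases "v \<in> S")
        case True
        then have "(z, y) \<in> ?R" "(y, v) \<in> ?R" using v y z complete complete' S_sub by auto
        then show ?thesis by (meson r_into_rtrancl rtrancl.rtrancl_into_rtrancl)
      next
        case False
        then have "(z, v) \<in> ?R" using v z complete S_sub by auto
        then show ?thesis by blast
      qed
    qed
  qed
  moreover have "card W < card (pverts G)"
    using assms(1) finite_parts card_verts by (simp add: card_gt_0_iff)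
  ultimately show ?thesis by (simp add: k_connected_iff[OF graph])
qed

text \<open>A set \<open>T\<close> deleted from \<open>H\<close> is deleted from \<open>G\<close>
  together with \<open>S\<close>.\<close>

lemma k_connected_joinD:
  assumes "S \<noteq> {}" "card W = card S + d" "k_connected (card W) G"
  shows "k_connected d H"
proof -
  have "conn_on (W - T) (parcs H)" if T: "T \<subseteq> W" "card T < d" for T
  proof -
    have "finite T" using T(1) finite_parts(2) finite_subset by blast
    then have "card (S \<union> T) < card W"
      using T assms(2) finite_parts(1) card_Un_le[of S T] by linarith
    moreover have "S \<union> T \<subseteq> pverts G" using T(1) S_sub by blast
    ultimately have "conn_on (pverts G - (S \<union> T)) (parcs G)"
      using assms(3) unfolding k_connected_iff[OF graph] by blast
    moreover have "pverts G - (S \<union> T) = W - T" by blast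
    ultimately show ?thesis using conn_on_Restr[of "W - T" W] by simp
  qed
  moreover have "d < card W" using assms(1,2) finite_parts by (simp add: card_gt_0_iff)
  ultimately show ?thesis by (simp add: k_connected_iff[OF graph_H])
qed

text \<open>An independent set not contained in \<open>S\<close> lies in \<open>W\<close>, since
  \<open>S\<close> is completely joined to \<open>W\<close>. It misses the at least \<open>d\<close>
  neighbours in \<open>H\<close> of any of its members, which leaves at most
  \<open>card W - d\<close> vertices.\<close>

lemma independence_number_join:
  assumes "card W = card S + d" "k_connected d H"
  shows "independence_number G = card S"
proof (rule antisym)
  obtain T where T: "independent_set G T" "card T = independence_number G"
    using obtain_max_independent_set[OF graph] .
  have "card T \<le> card S"
  proof (cases "T \<subseteq> S")
    case True
    then show ?thesis using finite_parts(1) by (rule card_mono[rotated])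
  next
    case False
    then obtain v where v: "v \<in> T" "v \<in> W" using T(1) by (auto simp: independent_set_def)
    then have TW: "T \<subseteq> W" using T(1) complete by (auto simp: independent_set_def)
    let ?N = "parcs H `` {v}"
    have "?N \<subseteq> W" "?N \<inter> T = {}" using T(1) v(1) by (auto simp: independent_set_def)
    then have "card ?N + card T \<le> card W"
      using TW finite_parts(2) card_Un_disjoint[of ?N T] card_mono[of W "?N \<union> T"]
      by (metis Un_least finite_subset)
    moreover have "d \<le> card ?N" using k_connected_degree[OF graph_H assms(2)] v(2) by simp
    ultimately show ?thesis using assms(1) by linarith
  qed
  then show "independence_number G \<le> card S" using T(2) by simp
  show "card S \<le> independence_number G" by (rule independent_set_card_le[OF graph indep])
qed

text \<open>The map \<open>h\<close> is left open so that the second factor can be moved to natural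
  numbers.\<close>

lemma isomorphic_graph_join:
  assumes h: "inj_on h W"
  shows "isomorphic G (graph_join (edgeless (card S)) \<lparr>pverts = h ` W, parcs = map_prod h h ` parcs H\<rparr>)"
proof -
  obtain g where g: "bij_betw g S {..<card S}"
    using ex_bij_betw_finite_nat[OF finite_parts(1)] by (auto simp: atLeast0LessThan)
  define f where "f v = (if v \<in> S then Inl (g v) else Inr (h v))" for v
  have "inj_on f (pverts G)"
    using h g by (auto simp: f_def inj_on_def bij_betw_def split: if_splits)
  moreover have fS: "f ` S = Inl ` {..<card S}"
    using g by (auto simp: f_def bij_betw_def image_image[symmetric])
  moreover have fW: "f ` W = Inr ` h ` W" by (auto simp: f_def image_image)
  moreover have "f ` pverts G = f ` S \<union> f ` W" using S_sub by blast
  moreover have "map_prod f f ` parcs G =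
    map_prod f f ` Restr (parcs G) W \<union> f ` S \<times> f ` W \<union> f ` W \<times> f ` S"
  proof -
    have "parcs G = Restr (parcs G) W \<union> S \<times> W \<union> W \<times> S"
      using S_free G(2) complete complete' by blast
    then have "map_prod f f ` parcs G = map_prod f f ` (Restr (parcs G) W \<union> S \<times> W \<union> W \<times> S)"
      by simp
    also have "\<dots> = map_prod f f ` Restr (parcs G) W \<union> f ` S \<times> f ` W \<union> f ` W \<times> f ` S"
      by (simp only: image_Un map_prod_surj_on[OF refl refl])
    finally show ?thesis .
  qed
  moreover have "map_prod f f ` Restr (parcs G) W = map_prod Inr Inr ` map_prod h h ` Restr (parcs G) W"
    unfolding image_image by (rule image_cong) (auto simp: f_def)
  ultimately show ?thesis
    unfolding isomorphic_iff[OF graph]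
    by (intro exI[of _ f]) (simp add: graph_join_def edgeless_def)
qed

end

text \<open>A vertex of \<open>S\<close> has all its neighbours outside \<open>S\<close> and, by the
  degree bound, at least as many as there are vertices there.\<close>

lemma edgeless_joinI:
  assumes "pair_graph G" "independent_set G S" "k_connected (card (pverts G - S)) G"
  shows "edgeless_join G S"
proof (rule edgeless_join.intro)
  note G = pair_graphD[OF assms(1)]
  show "S \<times> (pverts G - S) \<subseteq> parcs G"
  proof
    fix e assume "e \<in> S \<times> (pverts G - S)"
    then obtain s w where e: "e = (s, w)" "s \<in> S" "w \<in> pverts G - S" by auto
    have "parcs G `` {s} \<subseteq> pverts G - S"
      using assms(2) e(2) G(2) by (auto simp: independent_set_def)
    moreover have "card (pverts G - S) \<le> card (parcs G `` {s})"
      using k_connected_degree[OF assms(1,3)] assms(2) e(2) by (auto simp: independent_set_def)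
    ultimately have "parcs G `` {s} = pverts G - S" using G(1) by (intro card_seteq) auto
    then show "e \<in> parcs G" using e by blast
  qed
qed (use assms in auto)

lemma num_edges_graph_join:
  assumes "pair_graph H"
  shows "pair_graph (graph_join (edgeless s) H)"
    and "num_edges (graph_join (edgeless s) H) = s * card (pverts H) + num_edges H"
proof -
  note H = pair_graphD[OF assms]
  let ?J = "graph_join (edgeless s) H" and ?S = "Inl ` {..<s} :: (nat + 'a) set"
  have arcs: "parcs ?J = map_prod Inr Inr ` parcs H \<union> ?S \<times> Inr ` pverts H \<union> Inr ` pverts H \<times> ?S"
    and verts: "pverts ?J = ?S \<union> Inr ` pverts H"
    by (auto simp: graph_join_def edgeless_def)
  have "sym (parcs ?J)"
    unfolding arcs using symD[OF H(3)] by (intro symI) auto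
  moreover have "irrefl (parcs ?J)" unfolding arcs using H(4) by (auto simp: irrefl_def)
  moreover have "parcs ?J \<subseteq> pverts ?J \<times> pverts ?J" unfolding arcs verts using H(2) by auto
  ultimately show J: "pair_graph ?J" using H(1) by (simp add: pair_graph_iff verts)
  have W: "pverts ?J - ?S = Inr ` pverts H" unfolding verts by auto
  \<comment> \<open>The concrete join is an instance of the internal form, so
    \<open>num_edges_join\<close> counts its edges.\<close>
  interpret edgeless_join ?J ?S
    by (rule edgeless_join.intro[OF J]) (auto simp: independent_set_def W, auto simp: arcs verts)
  have "Restr (parcs ?J) (Inr ` pverts H) = map_prod Inr Inr ` parcs H"
    unfolding arcs using H(2) by auto
  then have "isomorphic H (induce ?J (pverts ?J - ?S))"
    unfolding isomorphic_iff[OF assms] W by (intro exI[of _ Inr]) simp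
  then show "num_edges ?J = s * card (pverts H) + num_edges H"
    using num_edges_join num_edges_isomorphic[OF assms graph_H] W
    by (simp add: card_image)
qed

section \<open>The minimum size\<close>

text \<open>The least number of edges of a \<open>d\<close>-connected graph of order \<open>k\<close>: minimum degree \<open>d\<close> forces
  \<open>\<lceil>k * d / 2\<rceil>\<close> edges, and only for \<open>d = 1\<close> does connectedness force more.\<close>

definition min_size :: "nat \<Rightarrow> nat \<Rightarrow> nat" where
  "min_size k d = (if d = 1 then k - 1 else (k * d + 1) div 2)"

lemma min_size_le:
  assumes "pair_graph H" "k_connected d H"
  shows "min_size (card (pverts H)) d \<le> num_edges H"
proof (cases "d = 1")
  case True
  note H = pair_graphD[OF assms(1)]
  have "pverts H \<noteq> {}" "conn_on (pverts H) (parcs H)"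
    using assms(2) True by (auto simp: k_connected_iff[OF assms(1)] dest: spec[of _ "{}"])
  then show ?thesis
    using connected_card_edges[OF H(1) _ H(3,5)] True by (simp add: min_size_def num_edges_eq)
next
  case False
  have "card (pverts H) * d \<le> 2 * num_edges H"
    by (rule degree_sum_le[OF assms(1) k_connected_degree[OF assms]])
  then show ?thesis using False by (simp add: min_size_def)
qed

text \<open>The order is at least 2 because a single vertex is a tree but not 1-connected.\<close>

lemma undirected_tree_iff_min_size:
  assumes "pair_graph H" "2 \<le> card (pverts H)"
  shows "undirected_tree H \<longleftrightarrow> k_connected 1 H \<and> num_edges H = min_size (card (pverts H)) 1"
proof -
  have "pverts H \<noteq> {}" using assms(2) by auto
  moreover have "conn_on (pverts H) (parcs H) \<longleftrightarrow> k_connected 1 H"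
  proof -
    \<comment> \<open>Finiteness matters, as infinite sets have cardinality 0 too.\<close>
    have "S \<subseteq> pverts H \<and> card S < 1 \<longleftrightarrow> S = {}" for S
      using pair_graphD(1)[OF assms(1)] finite_subset by fastforce
    then have "(\<forall>S \<subseteq> pverts H. card S < 1 \<longrightarrow> conn_on (pverts H - S) (parcs H)) \<longleftrightarrow>
        conn_on (pverts H - {}) (parcs H)"
      by metis
    then show ?thesis using assms(2) by (simp add: k_connected_iff[OF assms(1)])
  qed
  ultimately show ?thesis
    using assms(2) by (auto simp: undirected_tree_iff[OF assms(1)] min_size_def)
qed

text \<open>The witnesses are the edgeless graph for \<open>d = 0\<close>, a star for
  \<open>d = 1\<close> and a Harary graph for \<open>d \<ge> 2\<close>.\<close>

lemma obtain_min_size: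
  assumes "d + 2 \<le> k"
  obtains H :: "nat pair_pre_digraph"
  where "pair_graph H" "pverts H = {..<k}" "k_connected d H" "num_edges H = min_size k d"
proof -
  consider "d = 0" | "d = 1" | "2 \<le> d" by linarith
  then show ?thesis
  proof cases
    case 1
    let ?H = "edgeless k"
    have "pair_graph ?H" by (auto simp: pair_graph_iff edgeless_def sym_def irrefl_def)
    moreover from this have "k_connected d ?H"
      using 1 assms by (simp add: k_connected_iff) (simp add: edgeless_def)
    ultimately show ?thesis
      using that[of ?H] 1 by (simp add: min_size_def num_edges_def edgeless_def)
  next
    case 2
    \<comment> \<open>The star with centre 0, its edges directed outwards.\<close>
    define B where "B = {0::nat} \<times> {1..<k}"
    let ?H = "\<lparr>pverts = {..<k}, parcs = B \<union> B\<inverse>\<rparr>"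
    have H: "pair_graph ?H"
      using assms by (auto simp: pair_graph_iff sym_Un_converse B_def irrefl_def)
    have "(0, v) \<in> (Restr (B \<union> B\<inverse>) {..<k})\<^sup>*" if "v < k" for v
      using that assms by (cases "v = 0") (auto simp: B_def intro!: r_into_rtrancl)
    then have conn: "conn_on {..<k} (B \<union> B\<inverse>)"
      by (intro conn_onI_root[of _ _ 0] sym_Un_converse) simp
    have "edges B = (\<lambda>v. {0, v}) ` {1..<k}" by (auto simp: edges_def B_def)
    moreover have "inj_on (\<lambda>v. {0, v}) {1..<k}" by (auto simp: inj_on_def doubleton_eq_iff)
    ultimately have "num_edges ?H = k - 1" by (simp add: num_edges_eq edges_Un_converse card_image)
    moreover from this have "undirected_tree ?H"
      using conn assms 2 by (subst undirected_tree_iff[OF H]) (auto simp: lessThan_empty_iff)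
    ultimately show ?thesis
      using that[of ?H] H 2 assms undirected_tree_iff_min_size[OF H] by simp
  next
    case 3
    have H: "pair_graph (harary k d)" using pair_graph_harary assms by simp
    have con: "k_connected d (harary k d)" using k_connected_harary 3 assms by simp
    have verts: "pverts (harary k d) = {..<k}" by (simp add: harary_def)
    have "min_size k d = (k * d + 1) div 2" using 3 by (simp add: min_size_def)
    then have "num_edges (harary k d) = min_size k d"
      using num_edges_harary[of k d] min_size_le[OF H con] by (simp add: verts)
    then show ?thesis using that H con verts by blast
  qed
qed

text \<open>Any maximum independent set serves as \<open>S\<close>: exactly \<open>k\<close>
  vertices remain, so the degree bound forces a join.\<close>

lemma conn_class_decompose:
  assumes "G \<in> conn_class (\<alpha> + k) \<alpha> k" "0 < \<alpha>" "k = \<alpha> + d"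
  obtains S where "edgeless_join G S" "card S = \<alpha>" "card (pverts G - S) = k"
    "k_connected d (induce G (pverts G - S))"
proof -
  have G: "pair_graph G" "k_connected k G" "card (pverts G) = \<alpha> + k" "independence_number G = \<alpha>"
    using assms(1) by (auto simp: conn_class_def)
  obtain S where S: "independent_set G S" "card S = \<alpha>"
    using obtain_max_independent_set[OF G(1)] G(4) by metis
  then have "S \<subseteq> pverts G" by (simp add: independent_set_def)
  moreover from this have "finite S" using pair_graphD(1)[OF G(1)] finite_subset by blast
  ultimately have W: "card (pverts G - S) = k" using S(2) G(3) by (simp add: card_Diff_subset)
  then have join: "edgeless_join G S" using edgeless_joinI[OF G(1) S(1)] G(2) by simp
  moreover have "S \<noteq> {}" using S(2) assms(2) by auto
  ultimately have "k_connected d (induce G (pverts G - S))"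
    using edgeless_join.k_connected_joinD W S(2) assms(3) G(2) by metis
  then show ?thesis using that join S(2) W by blast
qed

lemma conn_class_num_edges_ge:
  assumes "G \<in> conn_class (\<alpha> + k) \<alpha> k" "0 < \<alpha>" "k = \<alpha> + d"
  shows "\<alpha> * k + min_size k d \<le> num_edges G"
proof -
  obtain S where S: "edgeless_join G S" "card S = \<alpha>" "card (pverts G - S) = k"
    "k_connected d (induce G (pverts G - S))"
    by (rule conn_class_decompose[OF assms])
  interpret edgeless_join G S by fact
  show ?thesis using num_edges_join min_size_le[OF graph_H S(4)] S(2,3) by simp
qed

text \<open>The lower bound holds throughout the class. It is attained by joining a smallest
  \<open>d\<close>-connected graph on \<open>{..<k}\<close> to an edgeless graph on the next
  \<open>\<alpha>\<close> numbers, a witness on natural numbers as \<open>min_edges\<close>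
  requires.\<close>

lemma min_edges_eq:
  assumes "2 \<le> \<alpha>" "k = \<alpha> + d"
  shows "min_edges (\<alpha> + k) \<alpha> k = \<alpha> * k + min_size k d"
proof -
  have "d + 2 \<le> k" using assms by simp
  then obtain H0 :: "nat pair_pre_digraph" where
    H0: "pair_graph H0" "pverts H0 = {..<k}" "k_connected d H0" "num_edges H0 = min_size k d"
    by (rule obtain_min_size)
  note H0' = pair_graphD[OF H0(1), unfolded H0(2)]
  define S where "S = {k..<k + \<alpha>}"
  define G where "G = \<lparr>pverts = {..<k + \<alpha>}, parcs = parcs H0 \<union> (S \<times> {..<k} \<union> {..<k} \<times> S)\<rparr>"
  have "sym (S \<times> {..<k} \<union> {..<k} \<times> S)" unfolding sym_def by blast
  then have "sym (parcs G)" using H0'(3) by (simp add: G_def sym_Un)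
  moreover have "irrefl (parcs G)" using H0'(4) by (auto simp: G_def irrefl_def S_def)
  moreover have "parcs G \<subseteq> pverts G \<times> pverts G" using H0'(2) by (auto simp: G_def S_def)
  ultimately have graph: "pair_graph G" by (simp add: pair_graph_iff G_def)
  have W: "pverts G - S = {..<k}" by (auto simp: G_def S_def)
  have ind: "induce G (pverts G - S) = H0"
    unfolding W induce_def using H0(2) H0'(2)
    by (intro pair_pre_digraph.equality) (auto simp: G_def S_def)
  interpret edgeless_join G S
    unfolding edgeless_join_def W using graph H0'(2)
    by (auto simp: independent_set_def G_def S_def)
  have S: "card S = \<alpha>" "S \<noteq> {}" using assms(1) by (auto simp: S_def)
  have "card W = card S + d" using W S(1) assms(2) by simp
  then have "k_connected k G" "independence_number G = \<alpha>"
    using k_connected_joinI[OF S(2), of d] independence_number_join[of d] H0(3) ind S(1) W by auto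
  then have "G \<in> conn_class (\<alpha> + k) \<alpha> k"
    using graph by (simp add: conn_class_def) (simp add: G_def)
  moreover have "num_edges G = \<alpha> * k + min_size k d"
    using num_edges_join ind W S(1) H0(4) by simp
  moreover have "\<alpha> * k + min_size k d \<le> num_edges G'"
    if "G' \<in> conn_class (\<alpha> + k) \<alpha> k" for G' :: "nat pair_pre_digraph"
    using conn_class_num_edges_ge[OF that _ assms(2)] assms(1) by simp
  ultimately show ?thesis unfolding min_edges_def by (intro Least_equality) auto
qed

section \<open>Extremal graphs as joins with a smallest \<open>d\<close>-connected graph\<close>

lemma ceiling_half: "\<lceil>real n / 2\<rceil> = int ((n + 1) div 2)"
proof (cases "even n")
  case True
  then show ?thesis by (auto elim!: evenE)
next
  case False
  then obtain m where "n = 2 * m + 1" by (rule oddE)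
  then show ?thesis by (intro ceiling_unique) auto
qed

theorem corollary3p2:
  fixes G :: "'a pair_pre_digraph" and \<alpha> k d :: nat
  assumes "2 \<le> \<alpha>" and "3 \<le> k" and "\<alpha> \<le> k" and "d = k - \<alpha>"
    and "pair_graph G" and "k_connected k G"
    and "card (pverts G) = \<alpha> + k" and "independence_number G = \<alpha>"
  shows "extremal (\<alpha> + k) \<alpha> k G \<longleftrightarrow>
    (\<exists>H :: nat pair_pre_digraph.
       pair_graph H \<and> card (pverts H) = k \<and>
       isomorphic G (graph_join (edgeless \<alpha>) H) \<and>
       (d = 0 \<longrightarrow> isomorphic H (edgeless k)) \<and>
       (d = 1 \<longrightarrow> undirected_tree H) \<and>
       (2 \<le> d \<longrightarrow> k_connected d H \<and> int (num_edges H) = \<lceil>real (k * d) / 2\<rceil>))"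
proof -
  have kd: "k = \<alpha> + d" using assms(3,4) by simp
  have G: "G \<in> conn_class (\<alpha> + k) \<alpha> k" using assms(5-8) by (simp add: conn_class_def)
  \<comment> \<open>\<open>G\<close> already lies in the class, so extremality is a matter of its
    number of edges alone.\<close>
  have extremal: "extremal (\<alpha> + k) \<alpha> k G \<longleftrightarrow> num_edges G = \<alpha> * k + min_size k d"
    using G by (simp add: extremal_def min_edges_eq[OF assms(1) kd])
  have edgeless: "isomorphic H (edgeless k) \<longleftrightarrow> num_edges H = 0"
    if H: "pair_graph H" "card (pverts H) = k" for H :: "nat pair_pre_digraph"
  proof
    assume "isomorphic H (edgeless k)"
    then show "num_edges H = 0"
      using H by (auto simp: isomorphic_iff edgeless_def num_edges_def)
  next
    assume "num_edges H = 0"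
    then have "parcs H = {}"
      using finite_edges[OF pair_graphD(5)[OF H(1)]] by (simp add: num_edges_eq edges_empty_iff)
    moreover obtain f where "bij_betw f (pverts H) {..<k}"
      using ex_bij_betw_finite_nat[OF pair_graphD(1)[OF H(1)]] H(2) by (auto simp: atLeast0LessThan)
    ultimately show "isomorphic H (edgeless k)"
      unfolding isomorphic_iff[OF H(1)]
      by (intro exI[of _ f]) (auto simp: bij_betw_def edgeless_def)
  qed
  \<comment> \<open>The three cases merge into one: \<open>H\<close> has the least size for its
    connectivity \<open>d\<close>. From here on no distinction by \<open>d\<close> is made.\<close>
  have conditions: "(d = 0 \<longrightarrow> isomorphic H (edgeless k)) \<and> (d = 1 \<longrightarrow> undirected_tree H) \<and>
      (2 \<le> d \<longrightarrow> k_connected d H \<and> int (num_edges H) = \<lceil>real (k * d) / 2\<rceil>) \<longleftrightarrow>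
      (0 < d \<longrightarrow> k_connected d H) \<and> num_edges H = min_size k d"
    if H: "pair_graph H" "card (pverts H) = k" for H :: "nat pair_pre_digraph"
  proof -
    consider "d = 0" | "d = 1" | "2 \<le> d" by linarith
    then show ?thesis
    proof cases
      case 1
      then show ?thesis using edgeless[OF H] by (simp add: min_size_def)
    next
      case 2
      then show ?thesis using undirected_tree_iff_min_size[OF H(1)] H(2) assms(2) by simp
    next
      case 3
      then show ?thesis by (simp only: ceiling_half) (auto simp: min_size_def)
    qed
  qed
  show ?thesis
  proof
    assume "extremal (\<alpha> + k) \<alpha> k G"
    then have size: "num_edges G = \<alpha> * k + min_size k d" using extremal by simp
    obtain S where S: "edgeless_join G S" "card S = \<alpha>" "card (pverts G - S) = k"
      "k_connected d (induce G (pverts G - S))"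
      using conn_class_decompose[OF G _ kd] assms(1) by auto
    interpret join: edgeless_join G S by fact
    \<comment> \<open>The statement asks for \<open>H\<close> on natural numbers, so the induced
      graph is renamed.\<close>
    obtain h :: "'a \<Rightarrow> nat" where h: "inj_on h join.W"
      using finite_imp_inj_to_nat_seg[OF join.finite_parts(2)] by blast
    let ?H = "\<lparr>pverts = h ` join.W, parcs = map_prod h h ` parcs join.H\<rparr>"
    have H: "pair_graph ?H" "card (pverts ?H) = k"
      using pair_graph_image[OF join.graph_H] h S(3) by (simp_all add: card_image)
    have "isomorphic join.H ?H" using h by (auto simp: isomorphic_iff[OF join.graph_H])
    then have "num_edges ?H = min_size k d"
      using num_edges_isomorphic[OF join.graph_H H(1)] join.num_edges_join S(2,3) size by simp
    moreover have "k_connected d ?H"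
      using k_connected_image[OF join.graph_H, of h d] h S(4) by simp
    moreover have "isomorphic G (graph_join (edgeless \<alpha>) ?H)"
      using join.isomorphic_graph_join[OF h] S(2) by simp
    ultimately show "\<exists>H :: nat pair_pre_digraph. pair_graph H \<and> card (pverts H) = k \<and>
       isomorphic G (graph_join (edgeless \<alpha>) H) \<and>
       (d = 0 \<longrightarrow> isomorphic H (edgeless k)) \<and> (d = 1 \<longrightarrow> undirected_tree H) \<and>
       (2 \<le> d \<longrightarrow> k_connected d H \<and> int (num_edges H) = \<lceil>real (k * d) / 2\<rceil>)"
      using H conditions[OF H] by blast
  next
    assume "\<exists>H :: nat pair_pre_digraph. pair_graph H \<and> card (pverts H) = k \<and>
       isomorphic G (graph_join (edgeless \<alpha>) H) \<and>
       (d = 0 \<longrightarrow> isomorphic H (edgeless k)) \<and> (d = 1 \<longrightarrow> undirected_tree H) \<and>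
       (2 \<le> d \<longrightarrow> k_connected d H \<and> int (num_edges H) = \<lceil>real (k * d) / 2\<rceil>)"
    then obtain H :: "nat pair_pre_digraph" where H: "pair_graph H" "card (pverts H) = k"
      and iso: "isomorphic G (graph_join (edgeless \<alpha>) H)" and size: "num_edges H = min_size k d"
      using conditions by blast
    have "num_edges G = \<alpha> * k + num_edges H"
      using num_edges_isomorphic[OF assms(5) num_edges_graph_join(1)[OF H(1)] iso]
        num_edges_graph_join(2)[OF H(1)] H(2) by simp
    then show "extremal (\<alpha> + k) \<alpha> k G" using extremal size by simp
  qed
qed

end
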